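(* Let $H$ be a separable Hilbert space, let $S(\cdot,\cdot)$ be a continuous symmetric bilinear form on $H$ with induced linear map $\mathcal{S}:H\to H^\ast$, $(\mathcal{S}u)(v)=S(u,v)$, and let $\phi$ be a nonzero continuous linear functional on $H$. Then: \begin{enumerate} \item If there is $u\in H$ such that $\mathcal{S}u=\phi$ and $\phi(u)=0$, then $n^\phi(S)=n(S)+1$. \item If $\phi\notin\overline{\mathrm{ran}(\mathcal{S})}$, then $n^\phi(S)=n(S)-1$. \item Otherwise, $n^\phi(S)=n(S)$. \end{enumerate}
   Context: Hilbert spaces are real. $H^\ast$ is the continuous dual of $H$ with its dual norm; $\mathrm{ran}(\mathcal{S})\subset H^\ast$ is the range of $\mathcal{S}$ and $\overline{\mathrm{ran}(\mathcal{S})}$ its norm closure. For a vector space $V$, the nullity $n(S,V)\in\{0,1,2,\dots\}\cup\{\infty\}$ is the dimension of the radical of $S$ on $V$, i.e. of $\{u\in V: S(u,v)=0\ \forall v\in V\}$. $n(S)=n(S,H)$ and $n^\phi(S)=n(S,\mathrm{Ker}(\phi))$. Convention: $\infty\pm1=\infty$. *)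

theory Defs
  imports "HOL-Analysis.Analysis" "HOL-Library.Extended_Nat"
begin

text \<open>The continuous dual \<open>H\<^sup>*\<close> with its dual norm is the type \<open>'a \<Rightarrow>\<^sub>L real\<close> of bounded linear
  functionals, normed by the operator norm.\<close>

definition induced_map :: "('a::real_normed_vector \<Rightarrow> 'a \<Rightarrow> real) \<Rightarrow> 'a \<Rightarrow> ('a \<Rightarrow>\<^sub>L real)" where
  "induced_map S u = Blinfun (S u)"

lemma blinfun_apply_induced_map:
  assumes "bounded_bilinear S"
  shows "blinfun_apply (induced_map S u) v = S u v"
  unfolding induced_map_def
  by (simp add: bounded_linear_Blinfun_apply bounded_bilinear.bounded_linear_right[OF assms])

text \<open>The library's \<open>dim\<close> is \<open>nat\<close>-valued and is \<open>0\<close> on infinite-dimensional spaces.\<close>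

definition ext_dim :: "'a::real_vector set \<Rightarrow> enat" where
  "ext_dim V = (if \<exists>B. finite B \<and> V \<subseteq> span B then enat (dim V) else \<infinity>)"

definition radical :: "('a \<Rightarrow> 'a \<Rightarrow> real) \<Rightarrow> 'a set \<Rightarrow> 'a set" where
  "radical S V = {u \<in> V. \<forall>v\<in>V. S u v = 0}"

text \<open>Subtraction on \<open>enat\<close> satisfies \<open>\<infinity> - 1 = \<infinity>\<close> but truncates \<open>0 - 1\<close> to \<open>0\<close>; an equation
  \<open>m = nullity S V - 1\<close> therefore has to be accompanied by \<open>1 \<le> nullity S V\<close>.\<close>

definition nullity :: "('a::real_vector \<Rightarrow> 'a \<Rightarrow> real) \<Rightarrow> 'a set \<Rightarrow> enat" where
  "nullity S V = ext_dim (radical S V)"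

definition functional_kernel :: "('a::real_normed_vector \<Rightarrow>\<^sub>L real) \<Rightarrow> 'a set" where
  "functional_kernel \<phi> = {u. blinfun_apply \<phi> u = 0}"

end

theory Submission
  imports Defs
begin

text \<open>
  Restricting a functional to the kernel \<open>K\<close> of \<open>\<phi>\<close> loses exactly the multiples of \<open>\<phi>\<close>, so the radical
  of \<open>S\<close> on \<open>K\<close> is \<open>{u \<in> K. \<S>u \<in> \<real>\<phi>}\<close>, to be compared with \<open>N = Ker \<S>\<close>. If \<open>\<phi> = \<S>u\<close> with
  \<open>\<phi>(u) = 0\<close>, symmetry gives \<open>N \<subseteq> K\<close> and the radical is \<open>N \<oplus> \<real>u\<close>. If \<open>\<phi>\<close> is not in the closure of
  \<open>ran \<S>\<close>, then by orthogonal projection \<open>\<phi>\<close> does not vanish on \<open>N\<close> (this is where completeness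
  enters), whence the radical is \<open>N \<inter> K\<close>, a hyperplane of \<open>N\<close>. Otherwise \<open>\<phi>\<close>
  vanishes on \<open>N\<close>, and the radical is \<open>N\<close>.
\<close>

section \<open>Orthogonal projection and the Riesz representation\<close>

lemma subspace_closure:
  fixes M :: "'a::real_normed_vector set"
  assumes M: "subspace M"
  shows "subspace (closure M)"
proof (rule subspaceI)
  show "0 \<in> closure M"
    using M closure_subset subspace_0 by blast
  show "x + y \<in> closure M" if xy: "x \<in> closure M" "y \<in> closure M" for x y
  proof -
    obtain f g where "\<And>n. f n \<in> M" "f \<longlonglongrightarrow> x" "\<And>n. g n \<in> M" "g \<longlonglongrightarrow> y"
      using xy unfolding closure_sequential by blast
    then have "(\<forall>n. f n + g n \<in> M) \<and> (\<lambda>n. f n + g n) \<longlonglongrightarrow> x + y"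
      using M by (simp add: subspace_add tendsto_add)
    then show ?thesis
      unfolding closure_sequential by (intro exI[of _ "\<lambda>n. f n + g n"])
  qed
  show "c *\<^sub>R x \<in> closure M" if x: "x \<in> closure M" for c x
  proof -
    obtain f where "\<And>n. f n \<in> M" "f \<longlonglongrightarrow> x"
      using x unfolding closure_sequential by blast
    then have "(\<forall>n. c *\<^sub>R f n \<in> M) \<and> (\<lambda>n. c *\<^sub>R f n) \<longlonglongrightarrow> c *\<^sub>R x"
      using M by (simp add: subspace_scale tendsto_scaleR)
    then show ?thesis
      unfolding closure_sequential by (intro exI[of _ "\<lambda>n. c *\<^sub>R f n"])
  qed
qed

text \<open>Midpoints of members of \<open>M\<close> lie in \<open>M\<close>, hence at distance at
  least \<open>d\<close> from \<open>x\<close>; when both endpoints are nearly at distance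
  \<open>d\<close>, the parallelogram law forces \<open>y i - y j\<close> to be short.\<close>

lemma minimizing_sequence_Cauchy:
  fixes x :: "'a::real_inner" and y :: "nat \<Rightarrow> 'a"
  assumes "subspace M" and y: "\<And>k. y k \<in> M"
    and d: "0 \<le> d" "\<And>m. m \<in> M \<Longrightarrow> d \<le> norm (x - m)"
    and lim: "(\<lambda>k. norm (x - y k)) \<longlonglongrightarrow> d"
  shows "Cauchy y"
proof -
  have key: "(norm (y i - y j))\<^sup>2 \<le> 2 * ((norm (x - y i))\<^sup>2 - d\<^sup>2) + 2 * ((norm (x - y j))\<^sup>2 - d\<^sup>2)"
    for i j
  proof -
    have "(1/2) *\<^sub>R (y i + y j) \<in> M"
      using assms(1) y by (simp add: subspace_add subspace_scale)
    then have "d\<^sup>2 \<le> (norm (x - (1/2) *\<^sub>R (y i + y j)))\<^sup>2"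
      using d by (intro power_mono) auto
    \<comment> \<open>the parallelogram law for \<open>x - y i\<close> and \<open>x - y j\<close>\<close>
    moreover have "(norm (y i - y j))\<^sup>2 = 2 * (norm (x - y i))\<^sup>2 + 2 * (norm (x - y j))\<^sup>2
        - 4 * (norm (x - (1/2) *\<^sub>R (y i + y j)))\<^sup>2"
      by (simp add: power2_norm_eq_inner inner_simps inner_commute algebra_simps)
    ultimately show ?thesis by simp
  qed
  have lim2: "(\<lambda>k. 2 * ((norm (x - y k))\<^sup>2 - d\<^sup>2)) \<longlonglongrightarrow> 0"
    using tendsto_mult_left[OF tendsto_diff[OF tendsto_power[OF lim, of 2] tendsto_const[of "d\<^sup>2"]], of 2]
    by simp
  show ?thesis
  proof (rule metric_CauchyI)
    fix e :: real assume e: "0 < e"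
    then have "\<forall>\<^sub>F k in sequentially. 2 * ((norm (x - y k))\<^sup>2 - d\<^sup>2) < e\<^sup>2 / 2"
      using order_tendstoD(2)[OF lim2, of "e\<^sup>2 / 2"] by simp
    then obtain n where n: "\<And>k. k \<ge> n \<Longrightarrow> 2 * ((norm (x - y k))\<^sup>2 - d\<^sup>2) < e\<^sup>2 / 2"
      unfolding eventually_sequentially by blast
    have "dist (y i) (y j) < e" if "i \<ge> n" "j \<ge> n" for i j
    proof -
      have "(norm (y i - y j))\<^sup>2 < e\<^sup>2"
        using key[of i j] n[OF that(1)] n[OF that(2)] by linarith
      then show ?thesis
        using e by (simp add: dist_norm power2_less_imp_less)
    qed
    then show "\<exists>n. \<forall>i\<ge>n. \<forall>j\<ge>n. dist (y i) (y j) < e" by blast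
  qed
qed

text \<open>If \<open>z \<bullet> m\<close> were nonzero, subtracting from \<open>z\<close> its
  component along \<open>m\<close> would strictly shorten it.\<close>

lemma nearest_point_orthogonal:
  fixes z :: "'a::real_inner"
  assumes "subspace M" and min: "\<And>m. m \<in> M \<Longrightarrow> norm z \<le> norm (z - m)" and m: "m \<in> M"
  shows "z \<bullet> m = 0"
proof (cases "m = 0")
  case False
  \<comment> \<open>The minimizer of \<open>norm (z - t *\<^sub>R m)\<close> over real
    \<open>t\<close>.\<close>
  define t where "t = (z \<bullet> m) / (m \<bullet> m)"
  have "norm z \<le> norm (z - t *\<^sub>R m)"
    using assms by (simp add: subspace_scale)
  then have "(norm z)\<^sup>2 \<le> (norm (z - t *\<^sub>R m))\<^sup>2"
    by (intro power_mono) auto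
  also have "\<dots> = (norm z)\<^sup>2 - (z \<bullet> m)\<^sup>2 / (m \<bullet> m)"
    using False unfolding power2_norm_eq_inner
    by (simp add: t_def inner_simps inner_commute[of m z] power2_eq_square)
  finally have "(z \<bullet> m)\<^sup>2 / (m \<bullet> m) \<le> 0" by simp
  moreover have "m \<bullet> m > 0" using False by simp
  ultimately have "(z \<bullet> m)\<^sup>2 \<le> 0" by (simp add: divide_le_0_iff)
  then show ?thesis by simp
qed simp

text \<open>The projection is the limit of a minimizing sequence: completeness supplies the limit,
  closedness keeps it in \<open>M\<close>.\<close>

lemma orthogonal_projection_exists:
  fixes x :: "'a::{real_inner, complete_space}"
  assumes M: "subspace M" "closed M"
  obtains y where "y \<in> M" "\<And>m. m \<in> M \<Longrightarrow> (x - y) \<bullet> m = 0"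
proof -
  define d where "d = infdist x M"
  have ne: "M \<noteq> {}" using M(1) subspace_0 by blast
  have d: "0 \<le> d" "\<And>m. m \<in> M \<Longrightarrow> d \<le> norm (x - m)"
    unfolding d_def by (auto simp: infdist_nonneg dist_norm[symmetric] infdist_le)
  \<comment> \<open>\<open>Suc k\<close> keeps the slack positive: \<open>inverse (real 0)\<close>
    is \<open>0\<close>, and no point of \<open>M\<close> is strictly closer than the
    infimum.\<close>
  have "\<exists>m\<in>M. norm (x - m) < d + inverse (real (Suc k))" for k
  proof -
    have "(INF m\<in>M. dist x m) < d + inverse (real (Suc k))"
      using ne by (simp add: d_def infdist_notempty)
    moreover have "bdd_below (dist x ` M)"
      by (intro bdd_belowI2[of _ 0]) simp
    ultimately show ?thesis
      using ne by (simp add: cINF_less_iff dist_norm)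
  qed
  then obtain y where y: "\<And>k. y k \<in> M" "\<And>k. norm (x - y k) < d + inverse (real (Suc k))"
    by metis
  have lim: "(\<lambda>k. norm (x - y k)) \<longlonglongrightarrow> d"
  proof (rule tendsto_sandwich)
    show "\<forall>\<^sub>F k in sequentially. d \<le> norm (x - y k)"
      using d(2) y(1) by simp
    show "\<forall>\<^sub>F k in sequentially. norm (x - y k) \<le> d + inverse (real (Suc k))"
      using y(2) by (intro always_eventually allI less_imp_le)
    show "(\<lambda>k. d + inverse (real (Suc k))) \<longlonglongrightarrow> d"
      using tendsto_add[OF tendsto_const LIMSEQ_inverse_real_of_nat, of d] by simp
    show "(\<lambda>k. d) \<longlonglongrightarrow> d" by simp
  qed
  from minimizing_sequence_Cauchy[OF M(1) y(1) d lim] obtain l where l: "y \<longlonglongrightarrow> l"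
    using Cauchy_convergent convergent_def by blast
  have lM: "l \<in> M"
    using closed_sequentially[OF M(2)] y(1) l by blast
  have "norm (x - l) = d"
    using LIMSEQ_unique[OF _ lim] tendsto_norm[OF tendsto_diff[OF tendsto_const l]] by blast
  then have "norm (x - l) \<le> norm ((x - l) - m)" if "m \<in> M" for m
    using d(2)[of "l + m"] that lM M(1) by (simp add: subspace_add diff_diff_eq)
  then show ?thesis
    using that lM nearest_point_orthogonal[OF M(1)] by blast
qed

text \<open>The kernel of a nonzero \<open>f\<close> is a closed hyperplane, so a vector
  \<open>z\<close> normal to it represents \<open>f\<close> up to a scalar, which the value at
  \<open>z\<close> fixes.\<close>

lemma riesz_representation:
  fixes f :: "'a::{real_inner, complete_space} \<Rightarrow>\<^sub>L real"
  shows "\<exists>w. \<forall>x. blinfun_apply f x = w \<bullet> x"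
proof (cases "f = 0")
  case True
  then show ?thesis by (intro exI[of _ 0]) simp
next
  case False
  then obtain v where v: "blinfun_apply f v \<noteq> 0"
    by (metis blinfun_eqI zero_blinfun.rep_eq)
  let ?M = "{x. blinfun_apply f x = 0}"
  have "subspace ?M"
    by (auto simp: subspace_def blinfun.bilinear_simps)
  moreover have "closed ?M"
    by (intro closed_Collect_eq continuous_intros)
  ultimately obtain y where y: "y \<in> ?M" "\<And>m. m \<in> ?M \<Longrightarrow> (v - y) \<bullet> m = 0"
    using orthogonal_projection_exists by blast
  define z where "z = v - y"
  have fz: "blinfun_apply f z \<noteq> 0"
    using v y(1) by (simp add: z_def blinfun.bilinear_simps)
  then have zz: "z \<bullet> z \<noteq> 0" by auto
  have "blinfun_apply f x = ((blinfun_apply f z / (z \<bullet> z)) *\<^sub>R z) \<bullet> x" for x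
  proof -
    \<comment> \<open>The right factor is \<open>x\<close> moved along \<open>z\<close> into the
      kernel of \<open>f\<close>, to which \<open>z\<close> is orthogonal.\<close>
    have "z \<bullet> (x - (blinfun_apply f x / blinfun_apply f z) *\<^sub>R z) = 0"
      using y(2) fz by (simp add: z_def[symmetric] blinfun.bilinear_simps)
    then show ?thesis
      using fz zz by (simp add: inner_simps field_simps)
  qed
  then show ?thesis by blast
qed

section \<open>Dimension of a one-step extension\<close>

text \<open>A finite basis of \<open>V\<close> stays independent when \<open>u\<close> joins it; if
  \<open>V\<close> lies in no finite span, neither does the larger space, and both sides are
  \<infinity>.\<close>

lemma ext_dim_span_insert:
  assumes V: "subspace V" and u: "u \<notin> V"
  shows "ext_dim (span (insert u V)) = ext_dim V + 1"
proof (cases "\<exists>B. finite B \<and> V \<subseteq> span B")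
  case True
  then obtain B where B: "finite B" "V \<subseteq> span B" by blast
  obtain C where C: "C \<subseteq> V" "independent C" "V \<subseteq> span C" "card C = dim V"
    using basis_exists by blast
  have fin: "finite C"
    using independent_span_bound[OF B(1) C(2)] C(1) B(2) by blast
  have sC: "span C = V"
    using C V by (metis span_subspace)
  have eq: "span (insert u V) = span (insert u C)"
    by (metis sC span_insert span_span)
  have ind: "independent (insert u C)"
    using u sC C(2) by (simp add: independent_insertI)
  have "dim (span (insert u V)) = card (insert u C)"
    unfolding eq using ind by (rule dim_span_eq_card_independent)
  also have "\<dots> = Suc (dim V)"
    using u C fin by (metis card_insert_disjoint subsetD)
  finally have "dim (span (insert u V)) = Suc (dim V)" .
  moreover have "\<exists>B. finite B \<and> span (insert u V) \<subseteq> span B"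
    using fin eq by (intro exI[of _ "insert u C"]) auto
  ultimately show ?thesis
    using True by (simp add: ext_dim_def one_enat_def)
next
  case False
  have "V \<subseteq> span (insert u V)"
    by (meson insert_subset span_superset subset_trans subset_insertI)
  then have "\<not> (\<exists>B. finite B \<and> span (insert u V) \<subseteq> span B)"
    using False by blast
  with False show ?thesis unfolding ext_dim_def by (simp only: if_False) simp
qed

section \<open>Radicals\<close>

lemma blinfun_eq_iff: "f = g \<longleftrightarrow> (\<forall>x. blinfun_apply f x = blinfun_apply g x)"
  by (auto intro: blinfun_eqI)

lemma radical_UNIV_alt:
  assumes "bounded_bilinear S"
  shows "radical S UNIV = {u. induced_map S u = 0}"
  by (auto simp: radical_def blinfun_eq_iff blinfun_apply_induced_map[OF assms])

text \<open>A functional vanishing on the kernel of \<phi> is a multiple of \<phi>. This makes the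
  radical comparable with the kernel of the induced map.\<close>

lemma radical_functional_kernel_alt:
  assumes S: "bounded_bilinear S"
  shows "radical S (functional_kernel \<phi>) =
    {u. blinfun_apply \<phi> u = 0 \<and> (\<exists>c. induced_map S u = c *\<^sub>R \<phi>)}"
proof -
  interpret bounded_bilinear S by fact
  have "\<exists>c. induced_map S u = c *\<^sub>R \<phi>"
    if "\<And>v. blinfun_apply \<phi> v = 0 \<Longrightarrow> S u v = 0" for u
  proof (cases "\<phi> = 0")
    case True
    then have "induced_map S u = 0 *\<^sub>R \<phi>"
      using that by (simp add: blinfun_eq_iff blinfun_apply_induced_map[OF S])
    then show ?thesis ..
  next
    case False
    then obtain w where w: "blinfun_apply \<phi> w \<noteq> 0"
      by (metis blinfun_eqI zero_blinfun.rep_eq)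
    \<comment> \<open>Evaluation at \<open>w\<close> forces this value; a general \<open>v\<close>
      is then moved along \<open>w\<close> into the kernel of \<phi>.\<close>
    define c where "c = S u w / blinfun_apply \<phi> w"
    have "S u v = c * blinfun_apply \<phi> v" for v
      using that[of "v - (blinfun_apply \<phi> v / blinfun_apply \<phi> w) *\<^sub>R w"] w
      by (simp add: c_def blinfun.bilinear_simps diff_right scaleR_right field_simps)
    then have "induced_map S u = c *\<^sub>R \<phi>"
      by (simp add: blinfun_eq_iff blinfun_apply_induced_map[OF S] blinfun.scaleR_left)
    then show ?thesis ..
  qed
  moreover have "S u v = 0" if "induced_map S u = c *\<^sub>R \<phi>" "blinfun_apply \<phi> v = 0" for u v c
    using that blinfun_apply_induced_map[OF S, of u v] by (simp add: blinfun.scaleR_left)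
  ultimately show ?thesis
    unfolding radical_def functional_kernel_def by blast
qed

lemma bounded_linear_induced_map:
  assumes S: "bounded_bilinear S"
  shows "bounded_linear (induced_map S)"
proof -
  interpret bounded_bilinear S by fact
  obtain K where K: "\<And>a b. norm (S a b) \<le> norm a * norm b * K" "0 \<le> K"
    using nonneg_bounded by blast
  show ?thesis
  proof (rule bounded_linear_intro[of _ K])
    fix x
    show "norm (induced_map S x) \<le> norm x * K"
      using K mult.commute[of "norm x" K]
      by (intro norm_blinfun_bound)
        (simp_all add: blinfun_apply_induced_map[OF S] mult.assoc mult.left_commute mult.commute[of _ K])
  qed (auto simp: blinfun_eq_iff blinfun_apply_induced_map[OF S] blinfun.bilinear_simps
      add_left scaleR_left)
qed

lemma subspace_radical_UNIV:
  assumes "bounded_bilinear S"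
  shows "subspace (radical S UNIV)"
  unfolding radical_UNIV_alt[OF assms]
  by (rule linear_subspace_kernel)
    (simp add: bounded_linear.linear bounded_linear_induced_map[OF assms])

section \<open>Closure of the range and vanishing on the radical\<close>

text \<open>By symmetry evaluation at \<open>n\<close> kills the range; being continuous on the
  dual, it kills the closure too.\<close>

lemma functional_in_closure_range_vanishes:
  fixes S :: "'a::real_normed_vector \<Rightarrow> 'a \<Rightarrow> real"
  assumes S: "bounded_bilinear S" and sym: "\<And>u v. S u v = S v u"
    and \<phi>: "\<phi> \<in> closure (range (induced_map S))" and n: "n \<in> radical S UNIV"
  shows "blinfun_apply \<phi> n = 0"
proof -
  have "closed {f :: 'a \<Rightarrow>\<^sub>L real. blinfun_apply f n = 0}"
    by (intro closed_Collect_eq continuous_intros)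
  moreover have "range (induced_map S) \<subseteq> {f. blinfun_apply f n = 0}"
    using n sym by (auto simp: radical_def blinfun_apply_induced_map[OF S])
  ultimately show ?thesis
    using \<phi> closure_minimal by blast
qed

text \<open>The witness is the residual of the Riesz vector \<open>w\<close> of \<phi> after
  projection onto the closure of the Riesz vectors of the range.\<close>

lemma functional_outside_closure_range:
  fixes S :: "'a::{real_inner, complete_space} \<Rightarrow> 'a \<Rightarrow> real"
  assumes S: "bounded_bilinear S" and sym: "\<And>u v. S u v = S v u"
    and \<phi>: "\<phi> \<notin> closure (range (induced_map S))"
  obtains n where "n \<in> radical S UNIV" "blinfun_apply \<phi> n \<noteq> 0"
proof -
  obtain w where w: "\<And>x. blinfun_apply \<phi> x = w \<bullet> x"
    using riesz_representation by blast
  let ?J = "blinfun_inner_left :: 'a \<Rightarrow> 'a \<Rightarrow>\<^sub>L real"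
  \<comment> \<open>Pulling the range back along the Riesz map \<open>?J\<close> allows projecting
    in the Hilbert space itself.\<close>
  let ?A = "{a. ?J a \<in> range (induced_map S)}"
  have J: "bounded_linear ?J"
    by (rule bounded_linear_blinfun_inner_left)
  have A: "\<exists>a\<in>?A. \<forall>x. S u x = a \<bullet> x" for u
  proof -
    obtain a where a: "\<And>x. blinfun_apply (induced_map S u) x = a \<bullet> x"
      using riesz_representation by blast
    then have "?J a = induced_map S u"
      by (simp add: blinfun_eq_iff inner_commute)
    with a show ?thesis by (auto simp: blinfun_apply_induced_map[OF S])
  qed
  have "subspace ?A"
    using linear_subspace_vimage[OF bounded_linear.linear[OF J]
        linear_subspace_image[OF bounded_linear.linear[OF bounded_linear_induced_map[OF S]] subspace_UNIV]]
    by (simp add: vimage_def)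
  then have "subspace (closure ?A)" by (rule subspace_closure)
  then obtain y where y: "y \<in> closure ?A" "\<And>m. m \<in> closure ?A \<Longrightarrow> (w - y) \<bullet> m = 0"
    using orthogonal_projection_exists by blast
  \<comment> \<open>The residual is orthogonal to the Riesz vector of each \<open>S u\<close>;
    symmetry swaps the arguments.\<close>
  have "S (w - y) u = 0" for u
    using A[of u] y(2) closure_subset by (metis inner_commute subsetD sym)
  then have rad: "w - y \<in> radical S UNIV" by (simp add: radical_def)
  have "w \<noteq> y"
  \<comment> \<open>A zero residual would put \<open>w\<close> in the closure of \<open>?A\<close>,
    and continuity of \<open>?J\<close> would carry this to \<phi>.\<close>
  proof
    assume "w = y"
    then have "?J w \<in> ?J ` closure ?A"
      using y(1) by blast
    then have "?J w \<in> closure (?J ` ?A)"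
      using closure_bounded_linear_image_subset[OF J] by blast
    moreover have "?J w = \<phi>" by (simp add: blinfun_eq_iff w inner_commute)
    moreover have "?J ` ?A \<subseteq> range (induced_map S)" by blast
    ultimately show False using \<phi> closure_mono by blast
  qed
  moreover have "blinfun_apply \<phi> (w - y) = (w - y) \<bullet> (w - y)"
    using y(2)[OF y(1)] by (simp add: w inner_diff_right inner_diff_left inner_commute)
  ultimately have "blinfun_apply \<phi> (w - y) \<noteq> 0" by simp
  with rad show ?thesis by (rule that)
qed

section \<open>Comparison of the nullities in the three cases\<close>

text \<open>The vector \<open>u\<close> is the one new direction: any \<open>x\<close> mapped to
  \<open>c *\<^sub>R \<phi>\<close> differs from \<open>c *\<^sub>R u\<close> by an element of the
  radical of \<open>S\<close>.\<close>

lemma nullity_functional_kernel_attained: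
  fixes S :: "'a::real_normed_vector \<Rightarrow> 'a \<Rightarrow> real"
  assumes S: "bounded_bilinear S" and sym: "\<And>u v. S u v = S v u" and nz: "\<phi> \<noteq> 0"
    and u: "induced_map S u = \<phi>" "blinfun_apply \<phi> u = 0"
  shows "nullity S (functional_kernel \<phi>) = nullity S UNIV + 1"
proof -
  interpret A: bounded_linear "induced_map S"
    using S by (rule bounded_linear_induced_map)
  \<comment> \<open>As \<phi> lies in the range, it vanishes on the radical of
    \<open>S\<close>.\<close>
  have "\<phi> \<in> closure (range (induced_map S))"
    using u(1) closure_subset by fastforce
  note vanish = functional_in_closure_range_vanishes[OF S sym this]
  have "radical S (functional_kernel \<phi>) = span (insert u (radical S UNIV))"
  proof (intro set_eqI iffI)
    fix x assume "x \<in> radical S (functional_kernel \<phi>)"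
    then obtain c where "induced_map S x = c *\<^sub>R \<phi>"
      by (auto simp: radical_functional_kernel_alt[OF S])
    then have "x - c *\<^sub>R u \<in> radical S UNIV"
      by (simp add: radical_UNIV_alt[OF S] A.diff A.scaleR u(1))
    then show "x \<in> span (insert u (radical S UNIV))"
      using span_breakdown_eq span_base by blast
  next
    fix x assume "x \<in> span (insert u (radical S UNIV))"
    then obtain c where c: "x - c *\<^sub>R u \<in> radical S UNIV"
      using span_breakdown_eq span_eq_iff subspace_radical_UNIV[OF S] by blast
    then have "induced_map S x = c *\<^sub>R \<phi>"
      by (simp add: radical_UNIV_alt[OF S] A.diff A.scaleR u(1))
    moreover have "blinfun_apply \<phi> x = 0"
      using vanish[OF c] u(2) by (simp add: blinfun.bilinear_simps)
    ultimately show "x \<in> radical S (functional_kernel \<phi>)"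
      by (auto simp: radical_functional_kernel_alt[OF S])
  qed
  moreover have "u \<notin> radical S UNIV"
    using u(1) nz by (simp add: radical_UNIV_alt[OF S])
  ultimately show ?thesis
    by (simp add: nullity_def ext_dim_span_insert subspace_radical_UNIV[OF S])
qed

text \<open>Testing \<open>induced_map S u = c *\<^sub>R \<phi>\<close> at \<open>n\<close> gives
  \<open>c = 0\<close>, so passing to the kernel of \<phi> only cuts the radical by a hyperplane,
  with \<open>n\<close> spanning a complement. The additive form avoids truncated
  subtraction.\<close>

lemma nullity_UNIV_nonvanishing:
  fixes S :: "'a::real_normed_vector \<Rightarrow> 'a \<Rightarrow> real"
  assumes S: "bounded_bilinear S" and sym: "\<And>u v. S u v = S v u"
    and n: "n \<in> radical S UNIV" "blinfun_apply \<phi> n \<noteq> 0"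
  shows "nullity S UNIV = nullity S (functional_kernel \<phi>) + 1"
proof -
  let ?N = "radical S UNIV" and ?R = "radical S (functional_kernel \<phi>)"
  have R: "?R = ?N \<inter> functional_kernel \<phi>"
  proof -
    have "c = 0" if "induced_map S u = c *\<^sub>R \<phi>" for u c
    proof -
      have "c * blinfun_apply \<phi> n = S u n"
        using that by (simp add: blinfun.scaleR_left flip: blinfun_apply_induced_map[OF S])
      also have "\<dots> = 0" using n(1) sym[of u n] by (simp add: radical_def)
      finally show ?thesis using n(2) by simp
    qed
    then have "(\<exists>c. induced_map S u = c *\<^sub>R \<phi>) \<longleftrightarrow> induced_map S u = 0" for u
      using scale_zero_left[of \<phi>] by fastforce
    then show ?thesis
      unfolding radical_functional_kernel_alt[OF S] radical_UNIV_alt[OF S]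
      by (auto simp: functional_kernel_def)
  qed
  have sN: "subspace ?N" by (rule subspace_radical_UNIV[OF S])
  have sR: "subspace ?R"
    unfolding R using sN
    by (intro subspace_inter) (auto simp: functional_kernel_def subspace_def blinfun.bilinear_simps)
  have "?N = span (insert n ?R)"
  proof
    show "span (insert n ?R) \<subseteq> ?N"
      using n(1) R by (intro span_minimal sN) auto
    show "?N \<subseteq> span (insert n ?R)"
    proof
      fix x assume x: "x \<in> ?N"
      let ?c = "blinfun_apply \<phi> x / blinfun_apply \<phi> n"
      have "x - ?c *\<^sub>R n \<in> ?N"
        using x n(1) sN by (simp add: subspace_diff subspace_scale)
      then have "x - ?c *\<^sub>R n \<in> ?R"
        using n(2) unfolding R by (simp add: functional_kernel_def blinfun.bilinear_simps)
      then show "x \<in> span (insert n ?R)"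
        using span_breakdown_eq span_base by blast
    qed
  qed
  moreover have "n \<notin> ?R"
    using n(2) unfolding R by (simp add: functional_kernel_def)
  ultimately show ?thesis
    using ext_dim_span_insert[OF sR] by (simp add: nullity_def)
qed

text \<open>A nonzero multiple of \<phi> attained inside the kernel of \<phi> could be rescaled to
  the excluded solution, so only \<open>c = 0\<close> remains.\<close>

lemma nullity_functional_kernel_eq:
  fixes S :: "'a::real_normed_vector \<Rightarrow> 'a \<Rightarrow> real"
  assumes S: "bounded_bilinear S" and sym: "\<And>u v. S u v = S v u"
    and \<phi>: "\<phi> \<in> closure (range (induced_map S))"
    and no: "\<nexists>u. induced_map S u = \<phi> \<and> blinfun_apply \<phi> u = 0"
  shows "nullity S (functional_kernel \<phi>) = nullity S UNIV"
proof -
  interpret A: bounded_linear "induced_map S"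
    using S by (rule bounded_linear_induced_map)
  have "c = 0" if "induced_map S u = c *\<^sub>R \<phi>" "blinfun_apply \<phi> u = 0" for u c
  proof (rule ccontr)
    assume "c \<noteq> 0"
    then have "induced_map S (inverse c *\<^sub>R u) = \<phi>" "blinfun_apply \<phi> (inverse c *\<^sub>R u) = 0"
      using that by (simp_all add: A.scaleR blinfun.bilinear_simps)
    then show False using no by blast
  qed
  then have "blinfun_apply \<phi> u = 0 \<and> (\<exists>c. induced_map S u = c *\<^sub>R \<phi>) \<longleftrightarrow> induced_map S u = 0" for u
    using functional_in_closure_range_vanishes[OF S sym \<phi>, of u]
      scale_zero_left[of \<phi>]
    unfolding radical_UNIV_alt[OF S] by fastforce
  then have "radical S (functional_kernel \<phi>) = radical S UNIV"
    unfolding radical_functional_kernel_alt[OF S] radical_UNIV_alt[OF S] by simp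
  then show ?thesis by (simp add: nullity_def)
qed

theorem theorem1p4:
  fixes S :: "'a::{real_inner, complete_space} \<Rightarrow> 'a \<Rightarrow> real"
    and \<phi> :: "'a \<Rightarrow>\<^sub>L real"
  assumes separable: "separable_space (euclidean :: 'a topology)"
    and continuous_bilinear: "bounded_bilinear S"
    and symmetric: "\<And>u v. S u v = S v u"
    and nonzero: "\<phi> \<noteq> 0"
  shows "((\<exists>u. induced_map S u = \<phi> \<and> blinfun_apply \<phi> u = 0) \<longrightarrow>
           nullity S (functional_kernel \<phi>) = nullity S UNIV + 1) \<and>
         (\<phi> \<notin> closure (range (induced_map S)) \<longrightarrow>
           1 \<le> nullity S UNIV \<and> nullity S (functional_kernel \<phi>) = nullity S UNIV - 1) \<and>
         (\<not> (\<exists>u. induced_map S u = \<phi> \<and> blinfun_apply \<phi> u = 0) \<and>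
          \<not> \<phi> \<notin> closure (range (induced_map S)) \<longrightarrow>
           nullity S (functional_kernel \<phi>) = nullity S UNIV)"
proof (intro conjI impI)
  assume "\<exists>u. induced_map S u = \<phi> \<and> blinfun_apply \<phi> u = 0"
  then show "nullity S (functional_kernel \<phi>) = nullity S UNIV + 1"
    using nullity_functional_kernel_attained[OF continuous_bilinear symmetric nonzero] by blast
next
  assume "\<phi> \<notin> closure (range (induced_map S))"
  then obtain n where "n \<in> radical S UNIV" "blinfun_apply \<phi> n \<noteq> 0"
    using functional_outside_closure_range[OF continuous_bilinear symmetric] by blast
  then have eq: "nullity S UNIV = nullity S (functional_kernel \<phi>) + 1"
    using nullity_UNIV_nonvanishing[OF continuous_bilinear symmetric] by blast
  then show "1 \<le> nullity S UNIV" by simp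
  show "nullity S (functional_kernel \<phi>) = nullity S UNIV - 1"
    \<comment> \<open>On \<open>enat\<close>, adding and then subtracting \<open>1\<close> changes
      nothing, also at \<infinity>.\<close>
    unfolding eq by (cases "nullity S (functional_kernel \<phi>)") (auto simp: one_enat_def)
next
  assume "\<not> (\<exists>u. induced_map S u = \<phi> \<and> blinfun_apply \<phi> u = 0) \<and>
    \<not> \<phi> \<notin> closure (range (induced_map S))"
  then show "nullity S (functional_kernel \<phi>) = nullity S UNIV"
    using nullity_functional_kernel_eq[OF continuous_bilinear symmetric] by blast
qed

end
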